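(* Let $n\ge 1$ be an integer, let $I\subset[0,\infty)$ be an interval, and let $f:I\to\mathbb{R}$ be an $n$-times differentiable function on $I^\circ$ such that $f^{(n)}\in L^1[a,b]$, where $a,b\in I$, $a<b$. If $|f^{(n)}|$ is $s$-convex (in the second sense) on $[a,b]$ for some fixed $s\in(0,1]$, then for every $\lambda\in[a,b]$, $$\left|(-1)^n\int_a^b f(x)\,dx+\sum_{m=1}^n(-1)^{n-m+2}\left[\frac{(\lambda-a)^m-(\lambda-b)^m}{m!}\right]f^{(m-1)}(\lambda)\right|$$ $$\le\frac{1}{n!}\Big[\beta(s+1,n+1)\left((\lambda-a)^{n+1}|f^{(n)}(a)|+(b-\lambda)^{n+1}|f^{(n)}(b)|\right)+\beta(1,n+s+1)\left((\lambda-a)^{n+1}+(b-\lambda)^{n+1}\right)|f^{(n)}(\lambda)|\Big].$$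
   Context: $I^\circ$ denotes the interior of $I$. A real function $g$ on $[a,b]\subset[0,\infty)$ is $s$-convex (in the second sense), $s\in(0,1]$, if $g(tx+(1-t)y)\le t^s g(x)+(1-t)^s g(y)$ for all $x,y\in[a,b]$ and $t\in[0,1]$. The Beta function is $\beta(x,y)=\int_0^1 t^{x-1}(1-t)^{y-1}\,dt$ for $x,y>0$. It is understood that $f$ is $n$ times differentiable at every point of $[a,b]$ (one-sided at a point that is an endpoint of $I$), so that $f^{(n)}$ is defined on all of $[a,b]$; $f^{(0)}=f$. *)

theory Defs
  imports "HOL-Analysis.Analysis"
begin

text \<open>The derivative of order \<open>k\<close> of a function on \<open>I\<close>. Derivatives are taken within \<open>I\<close>,
  so for a nondegenerate interval they are the usual two-sided ones at interior points and
  one-sided ones at an endpoint belonging to \<open>I\<close>; values of \<open>f\<close> outside \<open>I\<close> play no role.\<close>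

primrec nth_deriv_within :: "nat \<Rightarrow> real set \<Rightarrow> (real \<Rightarrow> real) \<Rightarrow> real \<Rightarrow> real" where
  "nth_deriv_within 0 I f = f"
| "nth_deriv_within (Suc k) I f =
     (\<lambda>x. vector_derivative (nth_deriv_within k I f) (at x within I))"

text \<open>A function on \<open>I\<close> is \<open>n\<close> times differentiable at every point of \<open>S \<subseteq> I\<close>. This is meant for
  \<open>S\<close> relatively open in \<open>I\<close>, so that the derivatives of lower order that enter the difference
  quotients exist near every point of \<open>S\<close>.\<close>

definition n_times_differentiable_within_on ::
    "nat \<Rightarrow> (real \<Rightarrow> real) \<Rightarrow> real set \<Rightarrow> real set \<Rightarrow> bool" where
  "n_times_differentiable_within_on n f I S \<longleftrightarrow>
     (\<forall>k<n. \<forall>x\<in>S. nth_deriv_within k I f differentiable (at x within I))"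

definition s_convex_on :: "real \<Rightarrow> real set \<Rightarrow> (real \<Rightarrow> real) \<Rightarrow> bool" where
  "s_convex_on s S g \<longleftrightarrow>
     (\<forall>x\<in>S. \<forall>y\<in>S. \<forall>t\<in>{0..1}.
        g (t * x + (1 - t) * y) \<le> t powr s * g x + (1 - t) powr s * g y)"

text \<open>The library's \<open>Beta\<close> is defined through the Gamma function; for positive real arguments
  it is Euler's integral.\<close>

lemma Beta_real_eq_integral:
  fixes x y :: real
  assumes "x > 0" "y > 0"
  shows "Beta x y = integral {0..1} (\<lambda>t. t powr (x - 1) * (1 - t) powr (y - 1))"
  using has_integral_Beta_real[OF assms] by (simp add: integral_unique)

end

theory Submission
  imports Defs
begin

text \<open>Write \<open>D k\<close> for the derivative of order \<open>k\<close>. Integrating \<open>(x - c) ^ n / n! * D n x\<close> by parts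
  \<open>n\<close> times moves all derivatives onto the kernel and leaves \<open>(-1) ^ n\<close> times the integral of \<open>f\<close>.
  Taking \<open>c = a\<close> on \<open>[a, l]\<close> and \<open>c = b\<close> on \<open>[l, b]\<close> makes the boundary terms at \<open>a\<close> and at \<open>b\<close>
  vanish, because the kernel has a zero there; the terms at \<open>l\<close> combine to the sum in the theorem.
  Hence the expression to be estimated equals
  \[ \int_a^l \frac{(x-a)^n}{n!} D_n(x)\,dx + \int_l^b \frac{(x-b)^n}{n!} D_n(x)\,dx . \]
  The repeated integration by parts is packed into one antiderivative
  (\<open>by_parts_boundary_has_vector_derivative\<close>), so that the fundamental theorem of calculus is
  applied only once on each half. As \<open>D n\<close> may be discontinuous, the theorem is used for the
  Henstock-Kurzweil integral, where it holds for every derivative.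

  On each half, \<open>x\<close> is a convex combination of the two endpoints with weights
  \<open>t\<close> and \<open>1 - t\<close>, where \<open>t\<close> is the relative distance of \<open>x\<close> from the zero of the kernel. The
  convexity hypothesis bounds \<open>\<bar>D n x\<bar>\<close> by \<open>t\<^sup>s \<bar>D n l\<bar> + (1 - t)\<^sup>s \<bar>D n a\<bar>\<close> (or with \<open>b\<close> for \<open>a\<close>),
  and integrating these weights against \<open>t ^ n\<close> produces the two Beta values.\<close>

section \<open>Repeated integration by parts\<close>

text \<open>The boundary term of \<open>n\<close> integrations by parts against the kernel \<open>(x - c) ^ n / n!\<close>.\<close>

definition by_parts_boundary :: "nat \<Rightarrow> (nat \<Rightarrow> real \<Rightarrow> real) \<Rightarrow> real \<Rightarrow> real \<Rightarrow> real" where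
  "by_parts_boundary n D c x =
     (\<Sum>m=1..n. (-1) ^ (n - m) * ((x - c) ^ m / fact m) * D (m - 1) x)"

lemma by_parts_boundary_0 [simp]: "by_parts_boundary 0 D c x = 0"
  by (simp add: by_parts_boundary_def)

lemma by_parts_boundary_Suc:
  "by_parts_boundary (Suc n) D c x =
     (x - c) ^ Suc n / fact (Suc n) * D n x - by_parts_boundary n D c x"
proof -
  have "(\<Sum>m=1..n. (-1) ^ (Suc n - m) * ((x - c) ^ m / fact m) * D (m - 1) x)
      = - by_parts_boundary n D c x"
    unfolding by_parts_boundary_def sum_negf [symmetric]
    by (intro sum.cong) (auto simp: Suc_diff_le)
  then show ?thesis
    unfolding by_parts_boundary_def [of "Suc n"] by simp
qed

lemma by_parts_boundary_center [simp]: "by_parts_boundary n D c c = 0"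
  by (induction n) (simp_all add: by_parts_boundary_Suc)

text \<open>One more integration by parts adds the product of the new kernel with \<open>D n\<close>. By the product
  rule its derivative is the new integrand plus the old one, and the old one is cancelled by the
  change of sign of the previous boundary term.\<close>

lemma by_parts_boundary_has_vector_derivative:
  assumes "\<And>k. k < n \<Longrightarrow> (D k has_vector_derivative D (Suc k) x) (at x within S)"
  shows "(by_parts_boundary n D c has_vector_derivative
           (x - c) ^ n / fact n * D n x - (-1) ^ n * D 0 x) (at x within S)"
  using assms
proof (induction n)
  case 0
  then show ?case by (simp add: by_parts_boundary_def)
next
  case (Suc n)
  have kernel: "((\<lambda>x. (x - c) ^ Suc n / fact (Suc n)) has_real_derivative (x - c) ^ n / fact n)
      (at x within S)"
    by (rule derivative_eq_intros refl | simp add: field_simps del: of_nat_Suc)+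
  have deriv: "(D n has_real_derivative D (Suc n) x) (at x within S)"
    using Suc.prems [of n] by (simp add: has_real_derivative_iff_has_vector_derivative)
  have previous: "(by_parts_boundary n D c has_real_derivative
      (x - c) ^ n / fact n * D n x - (-1) ^ n * D 0 x) (at x within S)"
    using Suc.IH Suc.prems by (simp add: has_real_derivative_iff_has_vector_derivative)
  have "(by_parts_boundary (Suc n) D c has_real_derivative
      ((x - c) ^ n / fact n * D n x + D (Suc n) x * ((x - c) ^ Suc n / fact (Suc n)))
        - ((x - c) ^ n / fact n * D n x - (-1) ^ n * D 0 x)) (at x within S)"
    unfolding by_parts_boundary_Suc [abs_def]
    by (intro DERIV_diff DERIV_mult kernel deriv previous)
  then show ?case
    unfolding has_real_derivative_iff_has_vector_derivative
    by (simp add: algebra_simps)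
qed

lemma repeated_by_parts_has_integral:
  assumes "u \<le> v"
    and deriv: "\<And>k x. k < n \<Longrightarrow> x \<in> {u..v} \<Longrightarrow>
                  (D k has_vector_derivative D (Suc k) x) (at x within {u..v})"
    and "D 0 integrable_on {u..v}"
  shows "((\<lambda>x. (x - c) ^ n / fact n * D n x) has_integral
           by_parts_boundary n D c v - by_parts_boundary n D c u
             + (-1) ^ n * integral {u..v} (D 0)) {u..v}"
proof -
  have "((\<lambda>x. (x - c) ^ n / fact n * D n x - (-1) ^ n * D 0 x) has_integral
          by_parts_boundary n D c v - by_parts_boundary n D c u) {u..v}"
    by (intro fundamental_theorem_of_calculus by_parts_boundary_has_vector_derivative
        \<open>u \<le> v\<close> deriv)
  moreover have "((\<lambda>x. (-1) ^ n * D 0 x) has_integral (-1) ^ n * integral {u..v} (D 0)) {u..v}"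
    by (intro has_integral_mult_right integrable_integral assms)
  ultimately show ?thesis
    by (drule_tac has_integral_add) auto
qed

section \<open>Power moments of an s-convex function\<close>

lemma has_integral_power_mult_complement_powr:
  fixes s :: real
  assumes "n \<ge> 1" "0 < s"
  shows "((\<lambda>t. t ^ n * (1 - t) powr s) has_integral Beta (s + 1) (real n + 1)) {0..1}"
proof -
  have "((\<lambda>t. t powr real n * (1 - t) powr s) has_integral Beta (s + 1) (real n + 1)) {0..1}"
    using has_integral_Beta_real [of "real n + 1" "s + 1"] assms by (simp add: Beta_commute)
  then show ?thesis
    \<comment> \<open>At \<open>t = 0\<close> the two kinds of power agree only for a positive exponent, as \<open>0 powr 0 = 0\<close>.\<close>
    by (rule has_integral_eq [rotated]) (use \<open>n \<ge> 1\<close> in \<open>auto simp: powr_realpow'\<close>)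
qed

lemma has_integral_power_mult_powr:
  fixes s :: real
  assumes "0 < s"
  shows "((\<lambda>t. t ^ n * t powr s) has_integral Beta 1 (real n + s + 1)) {0..1}"
proof -
  have "((\<lambda>t. t powr (real n + s) * (1 - t) powr 0) has_integral Beta 1 (real n + s + 1)) {0..1}"
    using has_integral_Beta_real [of "real n + s + 1" 1] assms by (simp add: Beta_commute)
  then show ?thesis
    \<comment> \<open>The factor \<open>(1 - t) powr 0\<close> is \<open>0\<close> rather than \<open>1\<close> at the endpoint \<open>t = 1\<close>.\<close>
    by (rule has_integral_spike [OF negligible_sing [of 1], rotated])
       (use \<open>0 < s\<close> in \<open>auto simp: powr_add powr_realpow le_less\<close>)
qed

text \<open>The kernel vanishes at \<open>c\<close>, so \<open>\<bar>g c\<bar>\<close> carries the weight \<open>(1 - t)\<^sup>s\<close> and \<open>\<bar>g d\<bar>\<close> the weight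
  \<open>t\<^sup>s\<close>, where \<open>t = (x - c) / (d - c)\<close>. Rescaling to \<open>[0, 1]\<close> turns
  the integral of this majorant into the two Beta integrals and contributes \<open>n\<close> factors \<open>d - c\<close>
  from the kernel and one from \<open>dx\<close>.\<close>

lemma s_convex_power_moment_bound:
  fixes g :: "real \<Rightarrow> real"
  assumes "n \<ge> 1" "0 < s" "c \<le> d"
    and convex: "s_convex_on s {c..d} (\<lambda>x. \<bar>g x\<bar>)"
    and integrable: "(\<lambda>x. (x - c) ^ n * g x) integrable_on {c..d}"
  shows "\<bar>integral {c..d} (\<lambda>x. (x - c) ^ n * g x)\<bar> \<le>
           Beta (s + 1) (real n + 1) * ((d - c) ^ (n + 1) * \<bar>g c\<bar>)
           + Beta 1 (real n + s + 1) * ((d - c) ^ (n + 1) * \<bar>g d\<bar>)"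
proof (cases "c = d")
  case True
  then show ?thesis by simp
next
  case False
  with \<open>c \<le> d\<close> have "c < d" by simp
  define h where "h = (\<lambda>t. \<bar>g c\<bar> * (t ^ n * (1 - t) powr s) + \<bar>g d\<bar> * (t ^ n * t powr s))"
  define M where "M = \<bar>g c\<bar> * Beta (s + 1) (real n + 1) + \<bar>g d\<bar> * Beta 1 (real n + s + 1)"
  have "(h has_integral M) (cbox 0 1)"
    unfolding h_def M_def cbox_interval
    by (intro has_integral_add has_integral_mult_right has_integral_power_mult_complement_powr
        has_integral_power_mult_powr assms)
  from has_integral_affinity' [OF this, of "1 / (d - c)" "- c / (d - c)"] \<open>c < d\<close>
  have "((\<lambda>x. h (x / (d - c) - c / (d - c))) has_integral (d - c) * M)
          {(d - c) * (c / (d - c))..(d - c) * (1 + c / (d - c))}"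
    by (simp add: mult.commute)
  moreover have "(d - c) * (c / (d - c)) = c" "(d - c) * (1 + c / (d - c)) = d"
    using \<open>c < d\<close> by (simp_all add: distrib_left)
  ultimately have "((\<lambda>x. h ((x - c) / (d - c))) has_integral (d - c) * M) {c..d}"
    by (simp add: diff_divide_distrib)
  then have bound_integral:
    "((\<lambda>x. (d - c) ^ n * h ((x - c) / (d - c))) has_integral (d - c) ^ n * ((d - c) * M)) {c..d}"
    by (rule has_integral_mult_right)
  have pointwise: "norm ((x - c) ^ n * g x) \<le> (d - c) ^ n * h ((x - c) / (d - c))"
    if x: "x \<in> {c..d}" for x
  proof -
    define t where "t = (x - c) / (d - c)"
    have t: "t \<in> {0..1}" and xc: "x - c = (d - c) * t"
      using x \<open>c < d\<close> by (auto simp: t_def)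
    from xc have x_eq: "x = t * d + (1 - t) * c"
      by (simp add: algebra_simps)
    have "\<bar>g x\<bar> \<le> t powr s * \<bar>g d\<bar> + (1 - t) powr s * \<bar>g c\<bar>"
      using convex t \<open>c \<le> d\<close> unfolding s_convex_on_def x_eq by auto
    then have "(x - c) ^ n * \<bar>g x\<bar> \<le> (x - c) ^ n * (t powr s * \<bar>g d\<bar> + (1 - t) powr s * \<bar>g c\<bar>)"
      using x by (intro mult_left_mono) auto
    also have "\<dots> = (d - c) ^ n * h t"
      by (simp add: xc h_def power_mult_distrib distrib_left mult_ac)
    finally show ?thesis
      using x by (simp add: abs_mult t_def)
  qed
  have "\<bar>integral {c..d} (\<lambda>x. (x - c) ^ n * g x)\<bar> \<le> (d - c) ^ n * ((d - c) * M)"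
    using integral_norm_bound_integral
        [OF integrable has_integral_integrable [OF bound_integral] pointwise]
    unfolding integral_unique [OF bound_integral] by simp
  then show ?thesis
    by (simp add: M_def algebra_simps)
qed

lemma s_convex_on_reflect:
  assumes "s_convex_on s S g"
  shows "s_convex_on s (uminus ` S) (\<lambda>x. g (- x))"
proof -
  have "- (t * - x + (1 - t) * - y) = t * x + (1 - t) * y" for t x y :: real
    by (simp add: algebra_simps)
  then show ?thesis
    using assms by (simp only: s_convex_on_def ball_simps minus_minus)
qed

lemma s_convex_on_subset: "s_convex_on s S g \<Longrightarrow> T \<subseteq> S \<Longrightarrow> s_convex_on s T g"
  unfolding s_convex_on_def by blast

text \<open>The reflection \<open>x \<mapsto> - x\<close> exchanges the roles of the endpoints and costs only the sign
  \<open>(-1) ^ n\<close> of the kernel.\<close>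

lemma s_convex_power_moment_bound_right:
  fixes g :: "real \<Rightarrow> real"
  assumes "n \<ge> 1" "0 < s" "c \<le> d"
    and convex: "s_convex_on s {c..d} (\<lambda>x. \<bar>g x\<bar>)"
    and integrable: "(\<lambda>x. (x - d) ^ n * g x) integrable_on {c..d}"
  shows "\<bar>integral {c..d} (\<lambda>x. (x - d) ^ n * g x)\<bar> \<le>
           Beta (s + 1) (real n + 1) * ((d - c) ^ (n + 1) * \<bar>g d\<bar>)
           + Beta 1 (real n + s + 1) * ((d - c) ^ (n + 1) * \<bar>g c\<bar>)"
proof -
  have sign: "(x - - d) ^ n * g (- x) = (-1) ^ n * ((- x - d) ^ n * g (- x))" for x
    by (simp add: power_mult_distrib [symmetric] algebra_simps flip: mult.assoc)
  have reflected_integrable: "(\<lambda>x. (x - - d) ^ n * g (- x)) integrable_on {- d..- c}"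
    unfolding sign
    by (intro integrable_on_mult_right integrable
          Henstock_Kurzweil_Integration.integrable_reflect_real [where f = "\<lambda>x. (x - d) ^ n * g x", THEN iffD2])
  have "integral {- d..- c} (\<lambda>x. (x - - d) ^ n * g (- x))
      = (-1) ^ n * integral {c..d} (\<lambda>x. (x - d) ^ n * g x)"
    unfolding sign
    using Henstock_Kurzweil_Integration.integral_reflect_real [of d c "\<lambda>x. (x - d) ^ n * g x"]
    by simp
  moreover have "s_convex_on s {- d..- c} (\<lambda>x. \<bar>g (- x)\<bar>)"
    using s_convex_on_reflect [OF convex] by simp
  ultimately show ?thesis
    using s_convex_power_moment_bound [of n s "- d" "- c" "\<lambda>x. g (- x)"] assms
      reflected_integrable
    by (simp add: abs_mult power_abs)
qed

section \<open>The inequality\<close>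

theorem theorem2:
  fixes n :: nat and I :: "real set" and f :: "real \<Rightarrow> real" and a b s l :: real
  assumes "n \<ge> 1"
    and "is_interval I" and "I \<subseteq> {0..}"
    and "a \<in> I" and "b \<in> I" and "a < b"
    and "n_times_differentiable_within_on n f I (interior I \<union> {a..b})"
    and "nth_deriv_within n I f absolutely_integrable_on {a..b}"
    and "0 < s" and "s \<le> 1"
    and "s_convex_on s {a..b} (\<lambda>x. \<bar>nth_deriv_within n I f x\<bar>)"
    and "l \<in> {a..b}"
  shows "\<bar>(-1) ^ n * integral {a..b} f
            + (\<Sum>m=1..n. (-1) ^ (n - m + 2) * (((l - a) ^ m - (l - b) ^ m) / fact m)
                          * nth_deriv_within (m - 1) I f l)\<bar>
         \<le> 1 / fact n *
            (Beta (s + 1) (real n + 1)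
               * ((l - a) ^ (n + 1) * \<bar>nth_deriv_within n I f a\<bar>
                  + (b - l) ^ (n + 1) * \<bar>nth_deriv_within n I f b\<bar>)
             + Beta 1 (real n + s + 1)
               * ((l - a) ^ (n + 1) + (b - l) ^ (n + 1)) * \<bar>nth_deriv_within n I f l\<bar>)"
proof -
  define D where "D = (\<lambda>k. nth_deriv_within k I f)"
  have D0: "D 0 = f" by (simp add: D_def)
  have sub: "{a..b} \<subseteq> I"
    using assms by (metis is_interval_convex_1 interval_subset_is_interval cbox_interval)
  have deriv: "(D k has_vector_derivative D (Suc k) x) (at x within {a..b})"
    if "k < n" "x \<in> {a..b}" for k x
  proof -
    have "D k differentiable (at x within I)"
      using assms(7) that by (auto simp: n_times_differentiable_within_on_def D_def)
    then have "(D k has_vector_derivative D (Suc k) x) (at x within I)"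
      by (simp add: vector_derivative_works D_def)
    then show ?thesis
      by (rule has_vector_derivative_within_subset [OF _ sub])
  qed
  have "continuous_on {a..b} f"
    using deriv [of 0, THEN has_vector_derivative_continuous] \<open>n \<ge> 1\<close> unfolding D0
    by (simp add: continuous_on_eq_continuous_within)
  then have f_int: "f integrable_on {a..b}"
    by (rule integrable_continuous_real)
  have l: "a \<le> l" "l \<le> b" using \<open>l \<in> {a..b}\<close> by auto
  have left_sub: "{a..l} \<subseteq> {a..b}" and right_sub: "{l..b} \<subseteq> {a..b}" using l by auto

  have left: "((\<lambda>x. (x - a) ^ n / fact n * D n x) has_integral
      by_parts_boundary n D a l + (-1) ^ n * integral {a..l} f) {a..l}"
    using repeated_by_parts_has_integral [of a l n D a] l
      has_vector_derivative_within_subset [OF deriv left_sub]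
      integrable_on_subinterval [OF f_int left_sub]
    by (simp add: D0)
  have right: "((\<lambda>x. (x - b) ^ n / fact n * D n x) has_integral
      - by_parts_boundary n D b l + (-1) ^ n * integral {l..b} f) {l..b}"
    using repeated_by_parts_has_integral [of l b n D b] l
      has_vector_derivative_within_subset [OF deriv right_sub]
      integrable_on_subinterval [OF f_int right_sub]
    by (simp add: D0)

  define L where "L = integral {a..l} (\<lambda>x. (x - a) ^ n * D n x)"
  define R where "R = integral {l..b} (\<lambda>x. (x - b) ^ n * D n x)"
  have left_int: "(\<lambda>x. (x - a) ^ n * D n x) integrable_on {a..l}"
    and L: "by_parts_boundary n D a l + (-1) ^ n * integral {a..l} f = L / fact n"
    using has_integral_mult_right [OF left, of "fact n"] unfolding L_def
    by (auto simp: has_integral_iff field_simps)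
  have right_int: "(\<lambda>x. (x - b) ^ n * D n x) integrable_on {l..b}"
    and R: "- by_parts_boundary n D b l + (-1) ^ n * integral {l..b} f = R / fact n"
    using has_integral_mult_right [OF right, of "fact n"] unfolding R_def
    by (auto simp: has_integral_iff field_simps)

  have "(\<Sum>m=1..n. (-1) ^ (n - m + 2) * (((l - a) ^ m - (l - b) ^ m) / fact m) * D (m - 1) l)
      = by_parts_boundary n D a l - by_parts_boundary n D b l"
    unfolding by_parts_boundary_def sum_subtractf [symmetric]
    by (intro sum.cong) (auto simp: diff_divide_distrib algebra_simps)
  moreover have "integral {a..b} f = integral {a..l} f + integral {l..b} f"
    using Henstock_Kurzweil_Integration.integral_combine [OF l f_int] by simp
  ultimately have identity: "(-1) ^ n * integral {a..b} f
      + (\<Sum>m=1..n. (-1) ^ (n - m + 2) * (((l - a) ^ m - (l - b) ^ m) / fact m) * D (m - 1) l)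
      = 1 / fact n * (L + R)"
    using L R by (simp add: algebra_simps add_divide_distrib)

  have convex: "s_convex_on s {a..b} (\<lambda>x. \<bar>D n x\<bar>)"
    using assms(11) by (simp add: D_def)
  have "\<bar>L + R\<bar> \<le> \<bar>L\<bar> + \<bar>R\<bar>"
    by (rule abs_triangle_ineq)
  also have "\<bar>L\<bar> \<le> Beta (s + 1) (real n + 1) * ((l - a) ^ (n + 1) * \<bar>D n a\<bar>)
      + Beta 1 (real n + s + 1) * ((l - a) ^ (n + 1) * \<bar>D n l\<bar>)"
    unfolding L_def
    by (intro s_convex_power_moment_bound s_convex_on_subset [OF convex left_sub]
        left_int l assms)
  also have "\<bar>R\<bar> \<le> Beta (s + 1) (real n + 1) * ((b - l) ^ (n + 1) * \<bar>D n b\<bar>)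
      + Beta 1 (real n + s + 1) * ((b - l) ^ (n + 1) * \<bar>D n l\<bar>)"
    unfolding R_def
    by (intro s_convex_power_moment_bound_right s_convex_on_subset [OF convex right_sub]
        right_int l assms)
  finally have bound: "\<bar>L + R\<bar> \<le> Beta (s + 1) (real n + 1)
        * ((l - a) ^ (n + 1) * \<bar>D n a\<bar> + (b - l) ^ (n + 1) * \<bar>D n b\<bar>)
      + Beta 1 (real n + s + 1) * ((l - a) ^ (n + 1) + (b - l) ^ (n + 1)) * \<bar>D n l\<bar>"
    by (simp add: algebra_simps)
  have "\<bar>1 / fact n * (L + R)\<bar> = 1 / fact n * \<bar>L + R\<bar>"
    by (simp add: abs_mult)
  also note mult_left_mono [OF bound, of "1 / fact n"]
  finally show ?thesis
    unfolding identity [unfolded D_def] by (simp add: D_def)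
qed

end
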